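(* If an $n$-element meet semilattice $\langle S;\wedge\rangle$ has at least $25\cdot 2^{n-6}$ congruences, then it is planar.
   Context: Here $n$ is a positive integer, so the semilattice is finite. A meet semilattice is ordered by $x\le y\iff x\wedge y=x$. A finite semilattice is planar if it has a planar Hasse diagram, that is, a Hasse diagram (of its order) in which edges can intersect only at their endpoints, that is, at vertices. *)

theory Defs
  imports "HOL-Analysis.Line_Segment"
begin

text \<open>
  A meet semilattice is given by the library locale \<^locale>\<open>semilattice\<close> for its operation
  \<open>m\<close>; the elements are all elements of the underlying type.
\<close>

definition congruences :: "('a \<Rightarrow> 'a \<Rightarrow> 'a) \<Rightarrow> 'a rel set" where
  "congruences m =
     {r. equiv UNIV r \<and>
         (\<forall>x x' y y'. (x, x') \<in> r \<longrightarrow> (y, y') \<in> r \<longrightarrow> (m x y, m x' y') \<in> r)}"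

definition meet_le :: "('a \<Rightarrow> 'a \<Rightarrow> 'a) \<Rightarrow> 'a \<Rightarrow> 'a \<Rightarrow> bool" where
  "meet_le m x y \<longleftrightarrow> m x y = x"

definition covered_by :: "('a \<Rightarrow> 'a \<Rightarrow> bool) \<Rightarrow> 'a \<Rightarrow> 'a \<Rightarrow> bool" where
  "covered_by le x y \<longleftrightarrow>
     le x y \<and> x \<noteq> y \<and> (\<forall>z. le x z \<longrightarrow> le z y \<longrightarrow> z = x \<or> z = y)"

text \<open>
  A Hasse diagram is determined by the positions \<open>p\<close> of the vertices in the plane: the edges
  are the straight line segments joining each element to its covers. They go strictly upwards
  and pass through no vertex other than their two endpoints.
\<close>

definition hasse_diagram :: "('a \<Rightarrow> 'a \<Rightarrow> bool) \<Rightarrow> ('a \<Rightarrow> real \<times> real) \<Rightarrow> bool" where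
  "hasse_diagram le p \<longleftrightarrow>
     inj p \<and>
     (\<forall>x y. covered_by le x y \<longrightarrow> snd (p x) < snd (p y)) \<and>
     (\<forall>x y z. covered_by le x y \<longrightarrow> p z \<in> closed_segment (p x) (p y) \<longrightarrow> z = x \<or> z = y)"

text \<open>
  Any point common to two different edges has to be an endpoint of both of them.
\<close>

definition planar_hasse_diagram :: "('a \<Rightarrow> 'a \<Rightarrow> bool) \<Rightarrow> ('a \<Rightarrow> real \<times> real) \<Rightarrow> bool" where
  "planar_hasse_diagram le p \<longleftrightarrow>
     hasse_diagram le p \<and>
     (\<forall>a b c d. covered_by le a b \<longrightarrow> covered_by le c d \<longrightarrow> (a, b) \<noteq> (c, d) \<longrightarrow>
        closed_segment (p a) (p b) \<inter> closed_segment (p c) (p d) \<subseteq> {p a, p b} \<inter> {p c, p d})"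

definition planar_semilattice :: "('a \<Rightarrow> 'a \<Rightarrow> 'a) \<Rightarrow> bool" where
  "planar_semilattice m \<longleftrightarrow> (\<exists>p. planar_hasse_diagram (meet_le m) p)"

end

theory Submission
  imports Defs
begin

text \<open>
  Call an element of a meet semilattice saturated for a congruence if its principal filter is a
  union of blocks. In a finite meet semilattice a congruence is determined by its saturated
  elements, and these contain the least element and are closed under all joins that exist. Hence
  there are at most as many congruences as there are sets \<open>X\<close> with these two properties.

  Call \<open>c\<close> a proper join if it is the join of two incomparable elements \<open>a\<close> and \<open>b\<close>. Among the sets
  that contain the least element, one in eight violates the closure condition for a given pair by
  containing \<open>a\<close> and \<open>b\<close> but not \<open>c\<close>, and by the hypothesis at most \<open>7/32\<close> of these sets violate
  some condition. Two or more conditions therefore have to be violated together quite often, so that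
  they overlap a lot. Inclusion-exclusion turns this into the alternative of
  \<open>few_proper_joins\<close>: either all proper joins are equal to one element \<open>c\<close>, and all pairs share one
  element \<open>a\<close>, or there are exactly two pairs, with joins \<open>a \<or> b = c\<close> and \<open>a \<or> b' = c'\<close>,
  where \<open>c \<noteq> c'\<close>.

  An element that is not a proper join has at most one lower cover. If the elements of a
  down-closed set that contains all proper joins are drawn, the remaining ones can thus be added
  one by one, each of them attached to the drawing by a single short edge
  (\<open>drawing_add_pendant\<close>, \<open>drawing_extends\<close>). It remains to draw a suitable down-closed set, and this
  is done on a few vertical lines, with heights given by the sizes of principal ideals
  (\<open>drawing_in_columns\<close>). In the first case the elements below \<open>c\<close> other than \<open>a\<close> form a chain, which
  takes one line, and \<open>a\<close> is put on a second line. In the second case the elements below \<open>a\<close> are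
  on a middle line, with \<open>b < c\<close> to the left and \<open>b' < c'\<close> to the right of it; there is nothing else
  below \<open>c\<close> or \<open>c'\<close>.
\<close>

section \<open>Straight-line drawings\<close>

text \<open>
  The graph is arbitrary here, and not the full covering relation of an order, so that a drawing can
  be built up one vertex at a time.
\<close>

definition drawing :: "'a set \<Rightarrow> 'a rel \<Rightarrow> ('a \<Rightarrow> real \<times> real) \<Rightarrow> bool" where
  "drawing V E p \<longleftrightarrow>
     inj_on p V \<and>
     (\<forall>x y. (x, y) \<in> E \<longrightarrow> snd (p x) < snd (p y)) \<and>
     (\<forall>x y z. (x, y) \<in> E \<longrightarrow> z \<in> V \<longrightarrow> p z \<in> closed_segment (p x) (p y) \<longrightarrow> z = x \<or> z = y) \<and>
     (\<forall>a b c d. (a, b) \<in> E \<longrightarrow> (c, d) \<in> E \<longrightarrow> (a, b) \<noteq> (c, d) \<longrightarrow>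
        closed_segment (p a) (p b) \<inter> closed_segment (p c) (p d) \<subseteq> {p a, p b} \<inter> {p c, p d})"

text \<open>
  The part of the drawing that does not touch \<open>s\<close> is compact and so keeps a positive distance from
  \<open>s\<close>. A short edge from \<open>s\<close> to \<open>t\<close> can therefore only meet edges that end in \<open>s\<close>, and it meets these
  in \<open>s\<close> alone if its direction differs from theirs. This excludes finitely many directions only.
\<close>

lemma drawing_add_pendant:
  assumes dr: "drawing V E p" and fin: "finite V" and EV: "E \<subseteq> V \<times> V"
    and sV: "s \<in> V" and tV: "t \<notin> V"
  shows "\<exists>q. drawing (insert t V) (insert (s, t) E) q"
proof -
  have inj: "inj_on p V"
    and up: "\<And>x y. (x, y) \<in> E \<Longrightarrow> snd (p x) < snd (p y)"
    and vert: "\<And>x y z. (x, y) \<in> E \<Longrightarrow> z \<in> V \<Longrightarrow> p z \<in> closed_segment (p x) (p y) \<Longrightarrow> z = x \<or> z = y"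
    and cross: "\<And>a b c d. (a, b) \<in> E \<Longrightarrow> (c, d) \<in> E \<Longrightarrow> (a, b) \<noteq> (c, d) \<Longrightarrow>
        closed_segment (p a) (p b) \<inter> closed_segment (p c) (p d) \<subseteq> {p a, p b} \<inter> {p c, p d}"
    using dr unfolding drawing_def by blast+
  define E' where "E' = {e \<in> E. fst e \<noteq> s \<and> snd e \<noteq> s}"
  define K where "K = (\<Union>e\<in>E'. closed_segment (p (fst e)) (p (snd e))) \<union> p ` (V - {s})"
  have "finite E'"
    using finite_subset[OF EV] fin by (auto simp: E'_def)
  then have "closed K"
    unfolding K_def using fin
    by (intro closed_Un closed_UN finite_imp_closed finite_imageI finite_Diff) auto
  moreover have "p s \<notin> K"
    using vert sV inj by (fastforce simp: K_def E'_def inj_on_def)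
  ultimately obtain \<epsilon> where \<epsilon>: "\<epsilon> > 0" "ball (p s) \<epsilon> \<subseteq> - K"
    using open_contains_ball[of "- K"] by (auto simp: open_Compl)
  \<comment> \<open>The new edge gets direction \<open>(\<delta>, 1)\<close>. Edges at \<open>s\<close> are never horizontal, so that each of them
      is parallel to \<open>(\<delta>', 1)\<close> for exactly one \<open>\<delta>'\<close>, and this value is avoided.\<close>
  obtain \<delta> where \<delta>: "\<delta> \<notin> (\<lambda>y. (fst (p y) - fst (p s)) / (snd (p y) - snd (p s))) ` V"
    using ex_new_if_finite[OF infinite_UNIV_char_0] fin by blast
  define d :: "real \<times> real" where "d = (\<delta>, 1)"
  have d0: "norm d > 0" by (simp add: d_def zero_prod_def)
  define \<eta> where "\<eta> = \<epsilon> / (2 * norm d)"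
  have \<eta>: "\<eta> > 0" using \<epsilon> d0 by (simp add: \<eta>_def)
  define T where "T = p s + \<eta> *\<^sub>R d"
  have Tne: "T \<noteq> p s" using \<eta> d0 by (auto simp: T_def)
  have "dist (p s) T < \<epsilon>"
    using \<epsilon> d0 by (simp add: T_def dist_norm \<eta>_def)
  then have "closed_segment (p s) T \<subseteq> ball (p s) \<epsilon>"
    using \<epsilon> by (intro closed_segment_subset) auto
  then have far: "closed_segment (p s) T \<inter> K = {}" using \<epsilon> by blast
  have near: "x = p s" if x: "x \<in> closed_segment (p s) T" "x \<in> closed_segment (p s) (p y)"
    and y: "y \<in> V" "snd (p y) \<noteq> snd (p s)" for x y
  proof -
    obtain r where r: "x = (1 - r) *\<^sub>R p s + r *\<^sub>R T" using x(1) by (auto simp: in_segment)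
    obtain w where w: "x = (1 - w) *\<^sub>R p s + w *\<^sub>R p y" using x(2) by (auto simp: in_segment)
    have "r *\<^sub>R (T - p s) = w *\<^sub>R (p y - p s)" using r w by (simp add: algebra_simps)
    then have *: "r * (\<eta> * \<delta>) = w * (fst (p y) - fst (p s))" "r * \<eta> = w * (snd (p y) - snd (p s))"
      by (simp_all add: T_def d_def prod_eq_iff)
    have "w * ((snd (p y) - snd (p s)) * \<delta> - (fst (p y) - fst (p s)))
        = w * (snd (p y) - snd (p s)) * \<delta> - w * (fst (p y) - fst (p s))"
      by (simp add: algebra_simps)
    also have "\<dots> = 0" unfolding *[symmetric] by (simp add: mult.assoc)
    finally have "w * ((snd (p y) - snd (p s)) * \<delta> - (fst (p y) - fst (p s))) = 0" .
    moreover have "(snd (p y) - snd (p s)) * \<delta> - (fst (p y) - fst (p s)) \<noteq> 0"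
    proof
      assume "(snd (p y) - snd (p s)) * \<delta> - (fst (p y) - fst (p s)) = 0"
      then have "\<delta> = (fst (p y) - fst (p s)) / (snd (p y) - snd (p s))"
        using y(2) by (simp add: eq_divide_eq mult.commute)
      then show False using \<delta> y(1) by blast
    qed
    ultimately have "w = 0" by simp
    then show "x = p s" using w by simp
  qed
  have meet: "x = p s \<and> (a = s \<or> b = s)"
    if x: "x \<in> closed_segment (p s) T" "x \<in> closed_segment (p a) (p b)" and ab: "(a, b) \<in> E" for x a b
  proof (cases "a = s \<or> b = s")
    case True
    have "a \<in> V" "b \<in> V" using ab EV by auto
    then show ?thesis
      using True near[of x a] near[of x b] x up[OF ab] by (auto simp: closed_segment_commute)
  next
    case False
    then have "(a, b) \<in> E'" using ab by (auto simp: E'_def)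
    then have "x \<in> K" using x(2) by (force simp: K_def)
    then show ?thesis using far x(1) by blast
  qed
  have Tseg: "T \<notin> closed_segment (p a) (p b)" if "(a, b) \<in> E" for a b
    using meet[of T a b] that Tne by auto
  have TV: "T \<noteq> p z" if "z \<in> V" for z
    using far Tne that by (cases "z = s") (auto simp: K_def)
  have Vseg: "z = s" if "z \<in> V" "p z \<in> closed_segment (p s) T" for z
    using far that by (auto simp: K_def)
  define q where "q = p(t := T)"
  have qV: "q z = p z" if "z \<in> V" for z using that tV by (auto simp: q_def)
  have qt: "q t = T" by (simp add: q_def)
  have EV': "a \<in> V" "b \<in> V" if "(a, b) \<in> E" for a b using that EV by auto
  have "drawing (insert t V) (insert (s, t) E) q"
    unfolding drawing_def
  proof (intro conjI allI impI)
    show "inj_on q (insert t V)"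
      using inj TV tV by (auto simp: inj_on_def qV qt)
  next
    fix x y assume "(x, y) \<in> insert (s, t) E"
    then show "snd (q x) < snd (q y)"
      using up EV' sV \<eta> by (auto simp: qV qt T_def d_def)
  next
    fix x y z
    assume *: "(x, y) \<in> insert (s, t) E" "z \<in> insert t V" "q z \<in> closed_segment (q x) (q y)"
    show "z = x \<or> z = y"
    proof (cases "(x, y) \<in> E")
      case True
      then show ?thesis
        using * vert[OF True, of z] Tseg[OF True] by (auto simp: qV[OF EV'(1)] qV[OF EV'(2)] qV qt)
    next
      case False
      then show ?thesis using * Vseg sV by (auto simp: qV qt)
    qed
  next
    fix a b c e
    assume *: "(a, b) \<in> insert (s, t) E" "(c, e) \<in> insert (s, t) E" "(a, b) \<noteq> (c, e)"
    consider "(a, b) \<in> E" "(c, e) \<in> E" | "(a, b) = (s, t)" "(c, e) \<in> E" | "(a, b) \<in> E" "(c, e) = (s, t)"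
      using * by blast
    then show "closed_segment (q a) (q b) \<inter> closed_segment (q c) (q e) \<subseteq> {q a, q b} \<inter> {q c, q e}"
    proof cases
      case 1
      then show ?thesis using cross[OF 1 *(3)] EV' by (simp add: qV)
    next
      case 2
      then show ?thesis using meet[of _ c e] EV'[OF 2(2)] sV by (auto simp: qV qt)
    next
      case 3
      then show ?thesis using meet[of _ a b] EV'[OF 3(1)] sV by (auto simp: qV qt)
    qed
  qed
  then show ?thesis by blast
qed

text \<open>
  Vertical edges can only meet in vertices, because no edge passes a vertex of its own column. Edges
  between neighbouring columns can only meet edges of the same strip, except in vertices. By the last
  assumption two such edges are weakly ordered at both ends in the same sense, so that a common
  interior point forces their ends to agree.
\<close>

lemma drawing_in_columns:
  fixes col :: "'a \<Rightarrow> int" and h :: "'a \<Rightarrow> nat"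
  defines "p \<equiv> \<lambda>x. (real_of_int (col x), real (h x))"
  assumes inj: "\<And>x y. x \<in> V \<Longrightarrow> y \<in> V \<Longrightarrow> col x = col y \<Longrightarrow> h x = h y \<Longrightarrow> x = y"
    and EV: "E \<subseteq> V \<times> V"
    and up: "\<And>x y. (x, y) \<in> E \<Longrightarrow> h x < h y"
    and step: "\<And>x y. (x, y) \<in> E \<Longrightarrow> \<bar>col x - col y\<bar> \<le> 1"
    and gap: "\<And>x y z. (x, y) \<in> E \<Longrightarrow> z \<in> V \<Longrightarrow> col x = col z \<Longrightarrow> col y = col z \<Longrightarrow>
                h x \<le> h z \<Longrightarrow> h z \<le> h y \<Longrightarrow> z = x \<or> z = y"
    and mono: "\<And>s t s' t'. (s, t) \<in> E \<union> E\<inverse> \<Longrightarrow> (s', t') \<in> E \<union> E\<inverse> \<Longrightarrow> col s' = col s \<Longrightarrow>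
                col t' = col t \<Longrightarrow> col t = col s + 1 \<Longrightarrow>
                h s \<le> h s' \<and> h t \<le> h t' \<or> h s' \<le> h s \<and> h t' \<le> h t"
  shows "drawing V E p"
proof -
  have EV': "a \<in> V" "b \<in> V" if "(a, b) \<in> E" for a b using that EV by auto
  have injp: "inj_on p V" using inj by (auto simp: inj_on_def p_def)
  have slanted: "\<exists>s t u. (s, t) \<in> E \<union> E\<inverse> \<and> {s, t} = {x, y} \<and> col t = col s + 1 \<and> 0 \<le> u \<and> u \<le> 1 \<and>
      q = (real_of_int (col s) + u, (1 - u) * real (h s) + u * real (h t))"
    if xy: "(x, y) \<in> E" "col x \<noteq> col y" and q: "q \<in> closed_segment (p x) (p y)" for x y and q :: "real \<times> real"
  proof -
    have "col y = col x + 1 \<or> col x = col y + 1" using step[OF xy(1)] xy(2) by linarith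
    then obtain s t where st: "(s, t) \<in> E \<union> E\<inverse>" "{s, t} = {x, y}" "col t = col s + 1"
      using xy(1) by auto
    then have "q \<in> closed_segment (p s) (p t)"
      using q by (auto simp: doubleton_eq_iff closed_segment_commute)
    then obtain u where u: "0 \<le> u" "u \<le> 1" "q = (1 - u) *\<^sub>R p s + u *\<^sub>R p t"
      by (auto simp: in_segment)
    have "q = (real_of_int (col s) + u, (1 - u) * real (h s) + u * real (h t))"
      using u(3) st(3) by (simp add: p_def algebra_simps)
    with st u(1,2) show ?thesis by (intro exI conjI)
  qed
  have integral: "q = p x \<or> q = p y"
    if xy: "(x, y) \<in> E" "col x \<noteq> col y" and q: "q \<in> closed_segment (p x) (p y)"
      and k: "fst q = real_of_int k" for x y and q :: "real \<times> real" and k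
  proof -
    obtain s t u where st: "{s, t} = {x, y}" "col t = col s + 1" "0 \<le> u" "u \<le> 1"
      and qq: "q = (real_of_int (col s) + u, (1 - u) * real (h s) + u * real (h t))" using slanted[OF xy q] by blast
    have "u = real_of_int (k - col s)" using k qq by simp
    then have "u = 0 \<or> u = 1" using st(3,4) by auto
    then have "q = p s \<or> q = p t" using qq st(2) by (auto simp: p_def)
    then show ?thesis using st(1) by (auto simp: doubleton_eq_iff)
  qed
  have vertical: "fst q = col x \<and> h x \<le> snd q \<and> snd q \<le> h y"
    if xy: "(x, y) \<in> E" "col x = col y" and q: "q \<in> closed_segment (p x) (p y)" for x y and q :: "real \<times> real"
  proof -
    obtain u where u: "0 \<le> u" "u \<le> 1" "q = (1 - u) *\<^sub>R p x + u *\<^sub>R p y"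
      using q by (auto simp: in_segment)
    have "snd q = h x + u * (real (h y) - h x)" "fst q = col x"
      using u(3) xy(2) by (auto simp: p_def algebra_simps)
    moreover have "u * (real (h y) - h x) \<ge> 0" "u * (real (h y) - h x) \<le> 1 * (real (h y) - h x)"
      using u up[OF xy(1)] by (auto intro!: mult_nonneg_nonneg mult_right_mono)
    ultimately show ?thesis by simp
  qed
  have vert: "z = x \<or> z = y"
    if xy: "(x, y) \<in> E" and z: "z \<in> V" and zs: "p z \<in> closed_segment (p x) (p y)" for x y z
  proof (cases "col x = col y")
    case True
    have "fst (p z) = col z" "snd (p z) = h z" by (simp_all add: p_def)
    then have "col x = col z" "h x \<le> h z" "h z \<le> h y"
      using vertical[OF xy True zs] by simp_all
    then show ?thesis using gap[OF xy z] True by metis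
  next
    case False
    then have "p z = p x \<or> p z = p y" using integral[OF xy False zs, of "col z"] by (simp add: p_def)
    then show ?thesis using inj_onD[OF injp _ z] EV'[OF xy] by metis
  qed
  have common: "q \<in> p ` V"
    if ab: "(a, b) \<in> E" and cd: "(c, d) \<in> E" and ne: "(a, b) \<noteq> (c, d)"
      and q: "q \<in> closed_segment (p a) (p b)" "q \<in> closed_segment (p c) (p d)" for a b c d and q :: "real \<times> real"
  proof (rule ccontr)
    assume nV: "q \<notin> p ` V"
    note V = EV'[OF ab] EV'[OF cd]
    have qn: "q \<noteq> p a" "q \<noteq> p b" "q \<noteq> p c" "q \<noteq> p d" using nV V by auto
    show False
    proof (cases "col a = col b \<or> col c = col d")
      case True
      then have cols: "col a = col b" "col c = col d"
        using integral[OF ab _ q(1)] integral[OF cd _ q(2)] vertical[OF ab _ q(1)] vertical[OF cd _ q(2)] qn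
        by blast+
      have v: "fst q = col a" "h a \<le> snd q" "snd q \<le> h b" "fst q = col c" "h c \<le> snd q" "snd q \<le> h d"
        using vertical[OF ab cols(1) q(1)] vertical[OF cd cols(2) q(2)] by auto
      then have cc: "col a = col c" by simp
      have lt: "h a < snd q" "snd q < h b" "h c < snd q" "snd q < h d"
        using v qn cols by (auto simp: p_def prod_eq_iff less_le)
      then have lt': "h a < h d" "h c < h b" by linarith+
      have "a = c"
      proof (cases "h a \<le> h c")
        case True
        then show ?thesis using gap[OF ab V(3)] cols cc lt' by auto
      next
        case False
        then show ?thesis using gap[OF cd V(1)] cols cc lt' by auto
      qed
      moreover have "b = d"
      proof (cases "h b \<le> h d")
        case True
        then show ?thesis using gap[OF cd V(2)] cols cc lt' by auto
      next
        case False
        then show ?thesis using gap[OF ab V(4)] cols cc lt' by auto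
      qed
      ultimately show False using ne by simp
    next
      case False
      \<comment> \<open>Neither edge is vertical: both lie in one strip, and the common point divides them in the
          same ratio \<open>u\<close>.\<close>
      obtain s t u where 1: "(s, t) \<in> E \<union> E\<inverse>" "{s, t} = {a, b}" "col t = col s + 1" "0 \<le> u" "u \<le> 1"
        "q = (real_of_int (col s) + u, (1 - u) * real (h s) + u * real (h t))" using slanted[OF ab _ q(1)] False by blast
      obtain s' t' u' where 2: "(s', t') \<in> E \<union> E\<inverse>" "{s', t'} = {c, d}" "col t' = col s' + 1" "0 \<le> u'" "u' \<le> 1"
        "q = (real_of_int (col s') + u', (1 - u') * real (h s') + u' * real (h t'))" using slanted[OF cd _ q(2)] False by blast
      have V': "s \<in> V" "t \<in> V" "s' \<in> V" "t' \<in> V" using 1(1) 2(1) EV by auto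
      have u1: "0 < u" "u < 1"
        using 1(3-6) nV V' by (auto simp: p_def less_le image_iff)
      have u2: "0 < u'" "u' < 1"
        using 2(3-6) nV V' by (auto simp: p_def less_le image_iff)
      have fq: "col s + u = col s' + u'" using 1(6) 2(6) by simp
      then have "real_of_int (col s - col s') < 1" "real_of_int (col s - col s') > - 1"
        using u1 u2 by auto
      then have cs: "col s' = col s" by linarith
      then have uu: "u' = u" using fq by simp
      have eq: "(1 - u) * h s + u * h t = (1 - u) * h s' + u * h t'" using 1(6) 2(6) uu by simp
      have "h s \<le> h s' \<and> h t \<le> h t' \<or> h s' \<le> h s \<and> h t' \<le> h t"
        using mono[OF 1(1) 2(1) cs _ 1(3)] cs 1(3) 2(3) by simp
      moreover have "h x = h x' \<and> h y = h y'"
        if "h x \<le> h x'" "h y \<le> h y'" "(1 - u) * h x + u * h y = (1 - u) * h x' + u * h y'" for x y x' y'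
      proof -
        have "(1 - u) * (real (h x') - h x) \<ge> 0" "u * (real (h y') - h y) \<ge> 0"
          using that u1 by auto
        moreover have "(1 - u) * (real (h x') - h x) + u * (real (h y') - h y) = 0"
          using that(3) by (simp add: algebra_simps)
        ultimately have "(1 - u) * (real (h x') - h x) = 0" "u * (real (h y') - h y) = 0" by linarith+
        then show ?thesis using u1 by simp
      qed
      ultimately have "h s = h s' \<and> h t = h t'" using eq eq[symmetric] by metis
      then have "s = s'" "t = t'" using inj V' cs 1(3) 2(3) by auto
      then have "{a, b} = {c, d}" using 1(2) 2(2) by simp
      then show False using ne up[OF ab] up[OF cd] by (auto simp: doubleton_eq_iff)
    qed
  qed
  show ?thesis
    unfolding drawing_def
  proof (intro conjI allI impI)
    show "inj_on p V" by (fact injp)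
    show "snd (p x) < snd (p y)" if "(x, y) \<in> E" for x y using up[OF that] by (simp add: p_def)
    show "z = x \<or> z = y" if "(x, y) \<in> E" "z \<in> V" "p z \<in> closed_segment (p x) (p y)" for x y z
      using vert that by blast
    show "closed_segment (p a) (p b) \<inter> closed_segment (p c) (p d) \<subseteq> {p a, p b} \<inter> {p c, p d}"
      if "(a, b) \<in> E" "(c, d) \<in> E" "(a, b) \<noteq> (c, d)" for a b c d
    proof
      fix q assume q: "q \<in> closed_segment (p a) (p b) \<inter> closed_segment (p c) (p d)"
      then have "q \<in> p ` V" using common[OF that] by blast
      then obtain z where "z \<in> V" "q = p z" by blast
      then show "q \<in> {p a, p b} \<inter> {p c, p d}"
        using q vert[OF that(1)] vert[OF that(2)] by auto
    qed
  qed
qed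

section \<open>Sets closed under many implications\<close>

lemma card_sets_between:
  fixes A B :: "'a::finite set"
  assumes "A \<inter> B = {}"
  shows "real (card {X. A \<subseteq> X \<and> X \<inter> B = {}}) = 2 ^ CARD('a) / 2 ^ card (A \<union> B)"
proof -
  have "bij_betw (\<lambda>Y. A \<union> Y) (Pow (- (A \<union> B))) {X. A \<subseteq> X \<and> X \<inter> B = {}}"
    by (rule bij_betw_byWitness[where f' = "\<lambda>X. X - A"]) (use assms in auto)
  then have "card {X. A \<subseteq> X \<and> X \<inter> B = {}} = 2 ^ card (- (A \<union> B))"
    by (metis bij_betw_same_card card_Pow finite_code)
  also have "card (- (A \<union> B)) = CARD('a) - card (A \<union> B)"
    by (simp add: Compl_eq_Diff_UNIV card_Diff_subset)
  finally have "real (card {X. A \<subseteq> X \<and> X \<inter> B = {}}) = 2 ^ (CARD('a) - card (A \<union> B))"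
    by simp
  also have "\<dots> = 2 ^ CARD('a) / 2 ^ card (A \<union> B)"
    by (rule power_diff) (auto intro: card_mono)
  finally show ?thesis .
qed

lemma card_Un_pairs:
  assumes "card e = 2" "card f = 2" "e \<noteq> f"
  shows "card (e \<union> f) \<ge> 3" "card (e \<union> f) \<le> 3 \<Longrightarrow> \<exists>x. e \<inter> f = {x}"
proof -
  have fin: "finite e" "finite f" using assms card.infinite by fastforce+
  have "e \<inter> f \<subset> e"
    using assms fin by (metis Int_lower1 Int_lower2 card_subset_eq psubsetI)
  then have *: "card (e \<inter> f) < 2" using assms fin psubset_card_mono by metis
  moreover have "card (e \<union> f) + card (e \<inter> f) = 4" using card_Un_Int[of e f] assms fin by simp
  ultimately show "card (e \<union> f) \<ge> 3" "card (e \<union> f) \<le> 3 \<Longrightarrow> \<exists>x. e \<inter> f = {x}"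
    by (auto simp flip: card_1_singleton_iff simp: One_nat_def)
qed

lemma pair_through:
  assumes "card e = 2" "a \<in> e"
  shows "\<exists>b. e = {a, b}"
proof -
  obtain x y where "e = {x, y}" using assms(1) by (auto simp: card_2_iff)
  then show ?thesis using assms(2) by (cases "a = x") (auto simp: doubleton_eq_iff)
qed

definition violating :: "'a \<Rightarrow> 'a set \<times> 'a \<Rightarrow> 'a set set" where
  "violating z i = {X. insert z (fst i) \<subseteq> X \<and> X \<inter> {snd i} = {}}"

text \<open>
  An implication \<open>(e, c)\<close> requires of a set that it contains \<open>c\<close> whenever it includes \<open>e\<close>. The family
  \<open>F\<close> consists of sets that satisfy all implications in \<open>D\<close> and contain \<open>z\<close>. Only half of all sets
  contain \<open>z\<close>, so that \<open>F\<close> makes up at least \<open>25/32\<close> of the candidates.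
\<close>

locale implications =
  fixes z :: "'a::finite" and D :: "('a set \<times> 'a) set" and F :: "'a set set"
  assumes two: "\<And>e c. (e, c) \<in> D \<Longrightarrow> card e = 2"
    and head_notin: "\<And>e c. (e, c) \<in> D \<Longrightarrow> c \<notin> e"
    and z_notin: "\<And>e c. (e, c) \<in> D \<Longrightarrow> z \<notin> insert c e"
    and head_unique: "\<And>e c d. (e, c) \<in> D \<Longrightarrow> (e, d) \<in> D \<Longrightarrow> c = d"
    and F_z: "\<And>X. X \<in> F \<Longrightarrow> z \<in> X"
    and F_closed: "\<And>X e c. X \<in> F \<Longrightarrow> (e, c) \<in> D \<Longrightarrow> e \<subseteq> X \<Longrightarrow> c \<in> X"
    and large: "64 * real (card F) \<ge> 25 * 2 ^ CARD('a)"
begin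

text \<open>
  Of the sets that contain \<open>z\<close>, one half of all sets, at least \<open>25/64\<close> of all sets violate nothing.
  This leaves \<open>1/2 - 25/64 = 7/64\<close>.
\<close>

lemma violating_le:
  assumes "I \<subseteq> D"
  shows "64 * real (card (\<Union>i\<in>I. violating z i)) \<le> 7 * 2 ^ CARD('a)"
proof -
  let ?U = "\<Union>i\<in>I. violating z i"
  have "F \<inter> ?U = {}"
    using assms F_closed by (fastforce simp: violating_def)
  then have "card F + card ?U = card (F \<union> ?U)" by (simp add: card_Un_disjoint)
  also have "\<dots> \<le> card {X::'a set. {z} \<subseteq> X \<and> X \<inter> {} = {}}"
    using F_z by (intro card_mono) (auto simp: violating_def)
  finally have "real (card F) + real (card ?U) \<le> 2 ^ CARD('a) / 2"
    using card_sets_between[of "{z}" "{}"] by simp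
  then show ?thesis using large by simp
qed

lemma violating_Int:
  "violating z (e, c) \<inter> violating z (f, d) = {X. insert z (e \<union> f) \<subseteq> X \<and> X \<inter> {c, d} = {}}"
  by (auto simp: violating_def)

lemma card_violating:
  assumes "(e, c) \<in> D"
  shows "real (card (violating z (e, c))) = 2 ^ CARD('a) / 16"
proof -
  have "insert z e \<inter> {c} = {}" and "card (insert z e \<union> {c}) = 4"
    using two[OF assms] head_notin[OF assms] z_notin[OF assms] by auto
  then show ?thesis
    unfolding violating_def fst_conv snd_conv by (subst card_sets_between) auto
qed

lemma card_violating_Int:
  assumes "(e, c) \<in> D" "(f, d) \<in> D" "c \<notin> f" "d \<notin> e"
  shows "real (card (violating z (e, c) \<inter> violating z (f, d))) =
           2 ^ CARD('a) / (2 * 2 ^ card (e \<union> f \<union> {c, d}))"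
proof -
  have "card (insert z (e \<union> f \<union> {c, d})) = Suc (card (e \<union> f \<union> {c, d}))"
    using z_notin[OF assms(1)] z_notin[OF assms(2)] by simp
  moreover have "insert z (e \<union> f) \<inter> {c, d} = {}"
    using assms head_notin z_notin by blast
  moreover have "insert z (e \<union> f) \<union> {c, d} = insert z (e \<union> f \<union> {c, d})" by blast
  ultimately show ?thesis
    unfolding violating_Int using card_sets_between[of "insert z (e \<union> f)" "{c, d}"] by simp
qed

text \<open>
  Each of the two implications is violated by \<open>4/64\<close> of all sets, and at least one of them by at most
  \<open>7/64\<close>, so that both are violated by at least \<open>1/64\<close>. In particular they can be violated together,
  and a joint violation prescribes membership for at most six elements, one of which is \<open>z\<close>.
\<close>

lemma two_implications:
  assumes ec: "(e, c) \<in> D" and fd: "(f, d) \<in> D" and ne: "e \<noteq> f"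
  shows "c \<notin> f" "d \<notin> e" "card (e \<union> f \<union> {c, d}) \<le> 5"
proof -
  let ?N = "2 ^ CARD('a) :: real"
  let ?V = "violating z (e, c)" and ?W = "violating z (f, d)"
  have "(\<Union>i\<in>{(e, c), (f, d)}. violating z i) = ?V \<union> ?W" by simp
  then have "64 * real (card (?V \<union> ?W)) \<le> 7 * ?N"
    using violating_le[of "{(e, c), (f, d)}"] ec fd by simp
  moreover have "real (card ?V) + real (card ?W) = real (card (?V \<union> ?W)) + real (card (?V \<inter> ?W))"
    using card_Un_Int[of ?V ?W] by simp
  ultimately have big: "64 * real (card (?V \<inter> ?W)) \<ge> ?N"
    using card_violating[OF ec] card_violating[OF fd] by simp
  moreover have "?N > 0" by simp
  ultimately have "real (card (?V \<inter> ?W)) > 0" by linarith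
  then have "?V \<inter> ?W \<noteq> {}" by auto
  then show *: "c \<notin> f" "d \<notin> e" by (auto simp: violating_def)
  have "2 * 2 ^ card (e \<union> f \<union> {c, d}) \<le> (64 :: real)"
    using big unfolding card_violating_Int[OF ec fd *] by (simp add: field_simps)
  then have "(2::real) ^ card (e \<union> f \<union> {c, d}) \<le> 2 ^ 5" by simp
  then show "card (e \<union> f \<union> {c, d}) \<le> 5"
    by (subst (asm) power_increasing_iff) auto
qed

text \<open>
  By inclusion-exclusion, the shares of the three pairwise joint violations add up to at least \<open>5/64\<close>
  plus the share of the joint violation of all three, which is positive. Each of the former is at most
  \<open>2/64\<close>, and at most \<open>1/64\<close> unless the two heads are equal and the two bodies meet. Since none of the
  three can be as small as \<open>1/64\<close>, the heads are equal and the bodies meet pairwise. The sum is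
  then at most \<open>6/64\<close>, so that at most \<open>1/64\<close> of all sets violate all three implications. Hence the
  bodies have at least four elements in total; in particular they are not the three sides of a
  triangle, and so they have an element in common.
\<close>

lemma three_implications:
  assumes ec: "(e, c) \<in> D" and fd: "(f, d) \<in> D" and gb: "(g, b) \<in> D"
    and ne: "e \<noteq> f" "e \<noteq> g" "f \<noteq> g"
  shows "c = d" "d = b" "\<exists>x. x \<in> e \<and> x \<in> f \<and> x \<in> g"
proof -
  let ?N = "2 ^ CARD('a) :: real"
  let ?U = "violating z (e, c)" and ?V = "violating z (f, d)" and ?W = "violating z (g, b)"
  note notin = two_implications(1,2)[OF ec fd ne(1)] two_implications(1,2)[OF ec gb ne(2)]
    two_implications(1,2)[OF fd gb ne(3)] head_notin[OF ec] head_notin[OF fd] head_notin[OF gb]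
    z_notin[OF ec] z_notin[OF fd] z_notin[OF gb]
  have "(\<Union>i\<in>{(e, c), (f, d), (g, b)}. violating z i) = ?U \<union> ?V \<union> ?W" by auto
  then have le: "64 * real (card (?U \<union> ?V \<union> ?W)) \<le> 7 * ?N"
    using violating_le[of "{(e, c), (f, d), (g, b)}"] ec fd gb by simp
  have "real (card ?U) + real (card ?V) + real (card ?W) + real (card (?U \<inter> ?V \<inter> ?W))
      = real (card (?U \<union> ?V \<union> ?W)) + real (card (?U \<inter> ?V)) + real (card (?U \<inter> ?W)) + real (card (?V \<inter> ?W))"
  proof -
    have "card ?U + card ?V = card (?U \<union> ?V) + card (?U \<inter> ?V)" by (rule card_Un_Int) auto
    moreover have "card (?U \<union> ?V) + card ?W = card (?U \<union> ?V \<union> ?W) + card ((?U \<union> ?V) \<inter> ?W)"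
      by (rule card_Un_Int) auto
    moreover have "card (?U \<inter> ?W) + card (?V \<inter> ?W) = card ((?U \<union> ?V) \<inter> ?W) + card (?U \<inter> ?V \<inter> ?W)"
      using card_Un_Int[of "?U \<inter> ?W" "?V \<inter> ?W"] by (simp add: Int_Un_distrib2 Int_assoc Int_left_commute)
    ultimately show ?thesis by simp
  qed
  then have ie: "5 * ?N + 64 * real (card (?U \<inter> ?V \<inter> ?W))
      \<le> 64 * real (card (?U \<inter> ?V)) + 64 * real (card (?U \<inter> ?W)) + 64 * real (card (?V \<inter> ?W))"
    using le card_violating[OF ec] card_violating[OF fd] card_violating[OF gb] by simp
  have triple: "?U \<inter> ?V \<inter> ?W = {X. insert z (e \<union> f \<union> g) \<subseteq> X \<and> X \<inter> {c, d, b} = {}}"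
    by (auto simp: violating_def)
  have dis: "insert z (e \<union> f \<union> g) \<inter> {c, d, b} = {}" using notin by blast
  have card3: "real (card (?U \<inter> ?V \<inter> ?W)) = ?N / 2 ^ card (insert z (e \<union> f \<union> g) \<union> {c, d, b})"
    unfolding triple by (rule card_sets_between[OF dis])
  have pos: "real (card (?U \<inter> ?V \<inter> ?W)) > 0" unfolding card3 by simp
  have pair: "64 * real (card (violating z (k, s) \<inter> violating z (l, t))) \<le> 2 * ?N \<and>
      (64 * real (card (violating z (k, s) \<inter> violating z (l, t))) > ?N \<longrightarrow> s = t \<and> card (k \<union> l) = 3)"
    if ks: "(k, s) \<in> D" and lt: "(l, t) \<in> D" and kl: "k \<noteq> l" for k s l t
  proof -
    note n = two_implications(1,2)[OF ks lt kl]
    note cv = card_violating_Int[OF ks lt n]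
    have "{s, t} \<inter> (k \<union> l) = {}" using n head_notin[OF ks] head_notin[OF lt] by blast
    then have cu: "card (k \<union> l \<union> {s, t}) = card (k \<union> l) + card {s, t}"
      by (subst card_Un_disjoint) auto
    have three: "card (k \<union> l) \<ge> 3" using card_Un_pairs(1)[OF two[OF ks] two[OF lt] kl] .
    have one: "card {s, t} \<ge> 1" by (simp add: Suc_le_eq card_gt_0_iff)
    have "(2::real) ^ 4 \<le> 2 ^ card (k \<union> l \<union> {s, t})"
      using cu three one by (intro power_increasing) auto
    then have "64 * real (card (violating z (k, s) \<inter> violating z (l, t))) \<le> 2 * ?N"
      unfolding cv by (simp add: field_simps)
    moreover have "s = t \<and> card (k \<union> l) = 3"
      if big: "64 * real (card (violating z (k, s) \<inter> violating z (l, t))) > ?N"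
    proof -
      have "(2::real) ^ card (k \<union> l \<union> {s, t}) < 2 ^ 5"
        using big unfolding cv by (simp add: field_simps)
      then have "card (k \<union> l \<union> {s, t}) < 5" by (subst (asm) power_strict_increasing_iff) auto
      then have "card {s, t} = 1" "card (k \<union> l) = 3" using cu three one by linarith+
      then show ?thesis by (auto simp: card_insert_if split: if_splits)
    qed
    ultimately show ?thesis by blast
  qed
  have UV: "c = d \<and> card (e \<union> f) = 3" and UW: "c = b \<and> card (e \<union> g) = 3" and VW: "d = b \<and> card (f \<union> g) = 3"
    using pair[OF ec fd ne(1)] pair[OF ec gb ne(2)] pair[OF fd gb ne(3)] ie pos by linarith+
  then show "c = d" "d = b" by auto
  have "64 * real (card (?U \<inter> ?V \<inter> ?W)) \<le> ?N"
    using pair[OF ec fd ne(1)] pair[OF ec gb ne(2)] pair[OF fd gb ne(3)] ie by linarith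
  then have "(2::real) ^ 6 \<le> 2 ^ card (insert z (e \<union> f \<union> g) \<union> {c, d, b})"
    unfolding card3 by (simp add: field_simps)
  then have "6 \<le> card (insert z (e \<union> f \<union> g) \<union> {c, d, b})"
    by (subst (asm) power_increasing_iff) auto
  also have "insert z (e \<union> f \<union> g) \<union> {c, d, b} = {z, c} \<union> (e \<union> f \<union> g)" using UV UW by auto
  also have "card \<dots> \<le> card {z, c} + card (e \<union> f \<union> g)" by (rule card_Un_le)
  also have "card {z, c} \<le> 2" by (simp add: card_insert_if)
  finally have four: "card (e \<union> f \<union> g) \<ge> 4" by simp
  show "\<exists>x. x \<in> e \<and> x \<in> f \<and> x \<in> g"
  proof (rule ccontr)
    assume no: "\<not> ?thesis"
    have "g \<subseteq> e \<union> f"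
    proof -
      obtain x where x: "e \<inter> g = {x}" using card_Un_pairs(2)[OF two[OF ec] two[OF gb] ne(2)] UW by auto
      obtain y where y: "f \<inter> g = {y}" using card_Un_pairs(2)[OF two[OF fd] two[OF gb] ne(3)] VW by auto
      have "x \<noteq> y" using no x y by blast
      then have "card {x, y} = card g" using two[OF gb] by simp
      moreover have "{x, y} \<subseteq> g" using x y by blast
      ultimately have "{x, y} = g" by (simp add: card_subset_eq)
      then show ?thesis using x y by blast
    qed
    then have "e \<union> f \<union> g = e \<union> f" by blast
    then show False using four UV by simp
  qed
qed

end

section \<open>Congruences and joins\<close>

locale finite_meet_semilattice = semilattice m for m :: "'a::finite \<Rightarrow> 'a \<Rightarrow> 'a"
begin

abbreviation le (infix "\<sqsubseteq>" 50) where "x \<sqsubseteq> y \<equiv> meet_le m x y"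

sublocale semilattice_order m "meet_le m" "\<lambda>x y. x \<sqsubseteq> y \<and> x \<noteq> y"
  by unfold_locales (auto simp: meet_le_def)

lemma least_of_meet_closed:
  assumes "A \<noteq> {}" and closed: "\<And>x y. x \<in> A \<Longrightarrow> y \<in> A \<Longrightarrow> m x y \<in> A"
  shows "\<exists>l\<in>A. \<forall>x\<in>A. l \<sqsubseteq> x"
proof -
  have "\<exists>l\<in>A. \<forall>x\<in>B. l \<sqsubseteq> x" if "finite B" "B \<noteq> {}" "B \<subseteq> A" for B
    using that
  proof (induction rule: finite_ne_induct)
    case (singleton x)
    then show ?case using refl by auto
  next
    case (insert x B)
    then obtain l where l: "l \<in> A" "\<forall>y\<in>B. l \<sqsubseteq> y" by blast
    have "m l x \<sqsubseteq> y" if "y \<in> insert x B" for y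
      using that l(2) cobounded1[of l x] cobounded2[of l x] trans by blast
    moreover have "m l x \<in> A" using l insert closed by auto
    ultimately show ?case by blast
  qed
  then show ?thesis using assms(1) by simp
qed

definition bottom :: 'a where "bottom = (SOME z. \<forall>x. z \<sqsubseteq> x)"

lemma bottom_le: "bottom \<sqsubseteq> x"
proof -
  have "\<exists>z. \<forall>x. z \<sqsubseteq> x" using least_of_meet_closed[of UNIV] by auto
  then show ?thesis unfolding bottom_def by (rule someI2_ex) blast
qed

definition is_join :: "'a \<Rightarrow> 'a \<Rightarrow> 'a \<Rightarrow> bool" where
  "is_join a b c \<longleftrightarrow> a \<sqsubseteq> c \<and> b \<sqsubseteq> c \<and> (\<forall>d. a \<sqsubseteq> d \<longrightarrow> b \<sqsubseteq> d \<longrightarrow> c \<sqsubseteq> d)"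

lemma is_join_exists:
  assumes "a \<sqsubseteq> d" "b \<sqsubseteq> d"
  shows "\<exists>c. is_join a b c"
  using least_of_meet_closed[of "{u. a \<sqsubseteq> u \<and> b \<sqsubseteq> u}"] assms boundedI
  unfolding is_join_def by blast

text \<open>
  For a congruence \<open>r\<close>, the elements whose principal filter is a union of blocks.
\<close>

definition saturated :: "'a rel \<Rightarrow> 'a set" where
  "saturated r = {a. \<forall>x y. (x, y) \<in> r \<longrightarrow> a \<sqsubseteq> x \<longrightarrow> a \<sqsubseteq> y}"

text \<open>
  The least element \<open>a\<close> of a block is saturated: if \<open>v\<close> and \<open>w\<close> are congruent and \<open>a\<close> is below \<open>v\<close>,
  then \<open>a = a \<and> v\<close> is congruent to \<open>a \<and> w\<close>, which is thus in the block of \<open>a\<close> and cannot be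
  smaller than \<open>a\<close>. Suppose that \<open>x\<close> and \<open>y\<close> have the same saturated elements below them, and let \<open>a\<close>
  and \<open>b\<close> be the least elements of their blocks. Then \<open>a = a \<and> y\<close> and \<open>b = x \<and> b\<close>, and both are
  congruent to \<open>x \<and> y\<close>.
\<close>

lemma congruence_iff_saturated:
  assumes r: "r \<in> congruences m"
  shows "(x, y) \<in> r \<longleftrightarrow> (\<forall>a\<in>saturated r. a \<sqsubseteq> x \<longleftrightarrow> a \<sqsubseteq> y)"
proof
  have eq: "equiv UNIV r" and cong: "\<And>x x' y y'. (x, x') \<in> r \<Longrightarrow> (y, y') \<in> r \<Longrightarrow> (m x y, m x' y') \<in> r"
    using r by (auto simp: congruences_def)
  have rfl: "(x, x) \<in> r" for x using eq by (auto simp: equiv_def refl_on_def)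
  have sym: "(y, x) \<in> r" if "(x, y) \<in> r" for x y using eq that by (auto simp: equiv_def dest: symD)
  have tra: "(x, w) \<in> r" if "(x, y) \<in> r" "(y, w) \<in> r" for x y w
    using eq that by (auto simp: equiv_def dest: transD)
  show "\<forall>a\<in>saturated r. a \<sqsubseteq> x \<longleftrightarrow> a \<sqsubseteq> y" if "(x, y) \<in> r"
    using that sym by (auto simp: saturated_def)
  have class_least: "\<exists>a\<in>saturated r. (a, x) \<in> r \<and> a \<sqsubseteq> x" for x
  proof -
    have "m u v \<in> {u. (u, x) \<in> r}" if "u \<in> {u. (u, x) \<in> r}" "v \<in> {u. (u, x) \<in> r}" for u v
      using cong[of u x v x] that by simp
    then obtain a where a: "(a, x) \<in> r" "\<And>u. (u, x) \<in> r \<Longrightarrow> a \<sqsubseteq> u"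
      using least_of_meet_closed[of "{u. (u, x) \<in> r}"] rfl by blast
    have "a \<sqsubseteq> w" if vw: "(v, w) \<in> r" and "a \<sqsubseteq> v" for v w
    proof -
      have "(m a v, m a w) \<in> r" using cong[OF rfl vw] .
      then have "(m a w, x) \<in> r" using \<open>a \<sqsubseteq> v\<close> a(1) sym tra by (metis meet_le_def)
      then show ?thesis using a(2) cobounded2 trans by blast
    qed
    then show ?thesis using a rfl by (auto simp: saturated_def)
  qed
  show "(x, y) \<in> r" if same: "\<forall>a\<in>saturated r. a \<sqsubseteq> x \<longleftrightarrow> a \<sqsubseteq> y"
  proof -
    obtain a where a: "a \<in> saturated r" "(a, x) \<in> r" "a \<sqsubseteq> x" using class_least by blast
    obtain b where b: "b \<in> saturated r" "(b, y) \<in> r" "b \<sqsubseteq> y" using class_least by blast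
    have "(m a y, m x y) \<in> r" "(m x b, m x y) \<in> r" using cong a b rfl by blast+
    moreover have "m a y = a" "m x b = b" using same a b by (auto simp: meet_le_def commute)
    ultimately show ?thesis using a b sym tra by metis
  qed
qed

lemma inj_on_saturated: "inj_on saturated (congruences m)"
proof (rule inj_onI)
  fix r s assume "r \<in> congruences m" "s \<in> congruences m" "saturated r = saturated s"
  then have "(x, y) \<in> r \<longleftrightarrow> (x, y) \<in> s" for x y by (simp add: congruence_iff_saturated)
  then show "r = s" by auto
qed

lemma saturated_join:
  assumes "a \<in> saturated r" "b \<in> saturated r" "is_join a b c"
  shows "c \<in> saturated r"
  unfolding saturated_def
proof (intro CollectI allI impI)
  fix x y assume xy: "(x, y) \<in> r" "c \<sqsubseteq> x"
  then have "a \<sqsubseteq> x" "b \<sqsubseteq> x" using assms(3) trans unfolding is_join_def by blast+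
  then show "c \<sqsubseteq> y" using assms xy(1) unfolding is_join_def saturated_def by blast
qed

text \<open>
  The two incomparable elements form an unordered pair, so that each closure condition is counted
  only once.
\<close>

definition proper_joins :: "('a set \<times> 'a) set" where
  "proper_joins = {({a, b}, c) | a b c. \<not> a \<sqsubseteq> b \<and> \<not> b \<sqsubseteq> a \<and> is_join a b c}"

lemma proper_joins_iff:
  "({a, b}, c) \<in> proper_joins \<longleftrightarrow> \<not> a \<sqsubseteq> b \<and> \<not> b \<sqsubseteq> a \<and> is_join a b c"
  unfolding proper_joins_def is_join_def by (auto simp: doubleton_eq_iff)

lemma proper_joinsE:
  assumes "(e, c) \<in> proper_joins"
  obtains a b where "e = {a, b}" "\<not> a \<sqsubseteq> b" "\<not> b \<sqsubseteq> a" "is_join a b c"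
  using assms unfolding proper_joins_def by blast

lemma incomparable_bounded:
  assumes "a \<sqsubseteq> d" "b \<sqsubseteq> d" "\<not> a \<sqsubseteq> b" "\<not> b \<sqsubseteq> a"
  shows "\<exists>c. ({a, b}, c) \<in> proper_joins \<and> c \<sqsubseteq> d"
  using is_join_exists[OF assms(1,2)] assms unfolding proper_joins_iff is_join_def by blast

text \<open>
  Otherwise every element of one pair is comparable to every element of the other. If \<open>a\<close> is below
  \<open>a'\<close>, then so is \<open>b\<close>, because \<open>a'\<close> below \<open>b\<close> would make \<open>a\<close> and \<open>b\<close> comparable. Hence the join \<open>c\<close>
  is below \<open>a'\<close>, and so is \<open>b'\<close>. The case of \<open>a'\<close> below \<open>a\<close> is similar.
\<close>

lemma disjoint_pairs_with_equal_join:
  assumes ec: "(e, c) \<in> proper_joins" and fc: "(f, c) \<in> proper_joins" and dis: "e \<inter> f = {}"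
  shows "\<exists>x\<in>e. \<exists>y\<in>f. \<exists>d. ({x, y}, d) \<in> proper_joins"
proof (rule ccontr)
  assume no: "\<not> ?thesis"
  obtain a b where ab: "e = {a, b}" "\<not> a \<sqsubseteq> b" "\<not> b \<sqsubseteq> a" "is_join a b c"
    using ec by (rule proper_joinsE)
  obtain a' b' where ab': "f = {a', b'}" "\<not> a' \<sqsubseteq> b'" "\<not> b' \<sqsubseteq> a'" "is_join a' b' c"
    using fc by (rule proper_joinsE)
  have cmp: "x \<sqsubseteq> y \<or> y \<sqsubseteq> x" if "x \<in> e" "y \<in> f" for x y
    using incomparable_bounded[of x c y] no that ab ab' unfolding is_join_def by blast
  consider "a \<sqsubseteq> a'" | "a' \<sqsubseteq> a" using cmp ab(1) ab'(1) by blast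
  then show False
  proof cases
    case 1
    then have "\<not> a' \<sqsubseteq> b" using ab(2) trans by blast
    then have "b \<sqsubseteq> a'" using cmp ab(1) ab'(1) by blast
    then have "c \<sqsubseteq> a'" using 1 ab(4) unfolding is_join_def by blast
    then show False using ab'(3,4) trans unfolding is_join_def by blast
  next
    case 2
    then have "\<not> a \<sqsubseteq> b'" using ab'(2) trans by blast
    then have "b' \<sqsubseteq> a" using cmp ab(1) ab'(1) by blast
    then have "c \<sqsubseteq> a" using 2 ab'(4) unfolding is_join_def by blast
    then show False using ab(3,4) trans unfolding is_join_def by blast
  qed
qed

text \<open>
  The closure conditions for proper joins are implications on the sets of saturated elements. With
  three pairs or more, any three of them share an element and have the same join; two distinct pairs
  already determine the shared element. With exactly two pairs, at most five elements
  are involved: either the joins are equal, and then disjoint pairs are impossible because they would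
  give rise to further pairs, or the joins differ, and then the pairs leave room for three elements
  only.
\<close>

lemma few_proper_joins:
  assumes large: "64 * real (card (congruences m)) \<ge> 25 * 2 ^ CARD('a)"
  shows "(\<exists>a c. \<forall>e d. (e, d) \<in> proper_joins \<longrightarrow> a \<in> e \<and> d = c) \<or>
         (\<exists>a b b' c c'. proper_joins = {({a, b}, c), ({a, b'}, c')} \<and> c \<noteq> c')"
proof -
  interpret implications bottom proper_joins "saturated ` congruences m"
  proof
    fix e c d assume ec: "(e, c) \<in> proper_joins"
    then obtain a b where ab: "e = {a, b}" "\<not> a \<sqsubseteq> b" "\<not> b \<sqsubseteq> a" "is_join a b c"
      by (rule proper_joinsE)
    then have "a \<noteq> b" using refl by blast
    then show "card e = 2" using ab by simp
    show "c \<notin> e" using ab unfolding is_join_def by auto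
    show "bottom \<notin> insert c e" using ab bottom_le trans unfolding is_join_def by blast
    assume "(e, d) \<in> proper_joins"
    then have "is_join a b d" using ab(1) proper_joins_iff by simp
    then show "c = d" using ab(4) antisym unfolding is_join_def by blast
  next
    show "bottom \<in> X" if "X \<in> saturated ` congruences m" for X
      using that bottom_le by (auto simp: saturated_def)
    show "c \<in> X" if "X \<in> saturated ` congruences m" "(e, c) \<in> proper_joins" "e \<subseteq> X" for X e c
    proof -
      obtain a b where ab: "e = {a, b}" "is_join a b c"
        using \<open>(e, c) \<in> proper_joins\<close> by (rule proper_joinsE)
      obtain r where "X = saturated r" using \<open>X \<in> saturated ` congruences m\<close> by blast
      then show ?thesis using saturated_join[OF _ _ ab(2)] ab(1) \<open>e \<subseteq> X\<close> by simp
    qed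
    show "25 * 2 ^ CARD('a) \<le> 64 * real (card (saturated ` congruences m))"
      using large by (simp add: card_image[OF inj_on_saturated])
  qed
  show ?thesis
  proof (cases "\<exists>e c f d g b. (e, c) \<in> proper_joins \<and> (f, d) \<in> proper_joins \<and> (g, b) \<in> proper_joins
                  \<and> e \<noteq> f \<and> e \<noteq> g \<and> f \<noteq> g")
    case True
    then obtain e c f d g b where efg: "(e, c) \<in> proper_joins" "(f, d) \<in> proper_joins" "(g, b) \<in> proper_joins"
      "e \<noteq> f" "e \<noteq> g" "f \<noteq> g" by blast
    obtain x where x: "x \<in> e" "x \<in> f" using three_implications(3)[OF efg] by blast
    have cd: "c = d" using three_implications(1)[OF efg] .
    have ef: "y = x" if "y \<in> e" "y \<in> f" for y
    proof (rule ccontr)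
      assume "y \<noteq> x"
      then have "card {x, y} = 2" by simp
      then have "{x, y} = h" if "x \<in> h" "y \<in> h" "card h = 2" for h
        using that card_subset_eq[of h "{x, y}"] by simp
      then have "{x, y} = e" "{x, y} = f"
        using x that two[OF efg(1)] two[OF efg(2)] by blast+
      then show False using efg(4) by simp
    qed
    have "x \<in> h \<and> k = c" if h: "(h, k) \<in> proper_joins" for h k
    proof (cases "h = e \<or> h = f")
      case True
      then show ?thesis
        using x cd head_unique[OF efg(1), of k] head_unique[OF efg(2), of k] h by auto
    next
      case False
      then have ne: "e \<noteq> h" "f \<noteq> h" by auto
      note T = three_implications[OF efg(1,2) h efg(4) ne]
      obtain y where "y \<in> e" "y \<in> f" "y \<in> h" using T(3) by blast
      then show ?thesis using ef[of y] T(1,2) by simp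
    qed
    then show ?thesis by (intro disjI1 exI[of _ x] exI[of _ c]) auto
  next
    case few: False
    show ?thesis
    proof (cases "\<exists>e c f d. (e, c) \<in> proper_joins \<and> (f, d) \<in> proper_joins \<and> e \<noteq> f")
      case True
      then obtain e c f d where ef: "(e, c) \<in> proper_joins" "(f, d) \<in> proper_joins" "e \<noteq> f" by blast
      have only: "(h = e \<and> k = c) \<or> (h = f \<and> k = d)" if "(h, k) \<in> proper_joins" for h k
      proof -
        have "h = e \<or> h = f" using few ef that by blast
        then show ?thesis
          using head_unique[OF ef(1), of k] head_unique[OF ef(2), of k] that by auto
      qed
      show ?thesis
      proof (cases "c = d")
        case True
        \<comment> \<open>Disjoint pairs with one join would entail a pair that meets both of them, hence a third one.\<close>
        have "e \<inter> f \<noteq> {}"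
        proof
          assume dis: "e \<inter> f = {}"
          then obtain x y z where "x \<in> e" "y \<in> f" "({x, y}, z) \<in> proper_joins"
            using disjoint_pairs_with_equal_join[OF ef(1) _ dis] ef(2) True by blast
          then show False using only dis by blast
        qed
        then obtain x where "x \<in> e" "x \<in> f" by blast
        then show ?thesis using only True by (intro disjI1 exI[of _ x] exI[of _ c]) auto
      next
        case False
        have "(e \<union> f) \<inter> {c, d} = {}" using two_implications(1,2)[OF ef] head_notin ef by blast
        then have "card (e \<union> f \<union> {c, d}) = card (e \<union> f) + 2"
          using False by (subst card_Un_disjoint) auto
        then have "card (e \<union> f) \<le> 3" using two_implications(3)[OF ef] by simp
        then obtain a where a: "e \<inter> f = {a}"
          using card_Un_pairs(2)[OF two[OF ef(1)] two[OF ef(2)] ef(3)] by blast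
        obtain b where b: "e = {a, b}" using pair_through[OF two[OF ef(1)]] a by blast
        obtain b' where b': "f = {a, b'}" using pair_through[OF two[OF ef(2)]] a by blast
        have "proper_joins = {({a, b}, c), ({a, b'}, d)}" using only ef b b' by auto
        then show ?thesis using False by blast
      qed
    next
      case one: False
      show ?thesis
      proof (cases "proper_joins = {}")
        case False
        then obtain e c where ec: "(e, c) \<in> proper_joins" by auto
        then obtain x where "x \<in> e" using two by fastforce
        have "x \<in> h \<and> k = c" if h: "(h, k) \<in> proper_joins" for h k
        proof -
          have "h = e" using one ec h by blast
          then show ?thesis using head_unique[OF ec, of k] h \<open>x \<in> e\<close> by simp
        qed
        then show ?thesis by (intro disjI1 exI[of _ x] exI[of _ c]) auto
      qed auto
    qed
  qed
qed

section \<open>Drawing the order\<close>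

abbreviation covered (infix "\<lhd>" 50) where "x \<lhd> y \<equiv> covered_by (meet_le m) x y"

definition covers_in :: "'a set \<Rightarrow> 'a rel" where
  "covers_in V = {(x, y). x \<lhd> y \<and> y \<in> V}"

definition height :: "'a \<Rightarrow> nat" where "height x = card {y. y \<sqsubseteq> x}"

lemma height_less:
  assumes "x \<sqsubseteq> y" "x \<noteq> y"
  shows "height x < height y"
proof -
  have "{z. z \<sqsubseteq> x} \<subset> {z. z \<sqsubseteq> y}" using assms trans antisym refl by blast
  then show ?thesis unfolding height_def by (simp add: psubset_card_mono)
qed

lemma height_le: "x \<sqsubseteq> y \<Longrightarrow> height x \<le> height y"
  using height_less[of x y] by (cases "x = y") auto

lemma le_of_height_le:
  assumes "x \<sqsubseteq> y \<or> y \<sqsubseteq> x" "height x \<le> height y"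
  shows "x \<sqsubseteq> y"
  using assms height_less[of y x] refl by (cases "x = y") auto

lemma eq_of_height_eq:
  assumes "x \<sqsubseteq> y \<or> y \<sqsubseteq> x" "height x = height y"
  shows "x = y"
  using assms height_less[of x y] height_less[of y x] by (cases "x = y") auto

lemma covers_gap:
  assumes xy: "x \<lhd> y" and cmp: "x \<sqsubseteq> z \<or> z \<sqsubseteq> x" "y \<sqsubseteq> z \<or> z \<sqsubseteq> y"
    and h: "height x \<le> height z" "height z \<le> height y"
  shows "z = x \<or> z = y"
proof -
  have "x \<sqsubseteq> z" "z \<sqsubseteq> y" using le_of_height_le cmp h by blast+
  then show ?thesis using xy unfolding covered_by_def by blast
qed

lemma lower_cover_exists:
  assumes "t \<noteq> bottom"
  shows "\<exists>s. s \<lhd> t"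
proof -
  let ?S = "{s. s \<sqsubseteq> t \<and> s \<noteq> t}"
  have "Max (height ` ?S) \<in> height ` ?S" using assms bottom_le by (intro Max_in) auto
  then obtain s where s: "s \<in> ?S" "height s = Max (height ` ?S)" by auto
  have "z = s \<or> z = t" if z: "s \<sqsubseteq> z" "z \<sqsubseteq> t" for z
  proof (rule ccontr)
    assume "\<not> (z = s \<or> z = t)"
    then have "z \<in> ?S" "height s < height z" using z height_less by auto
    moreover have "height z \<le> Max (height ` ?S)" using \<open>z \<in> ?S\<close> by simp
    ultimately show False using s(2) by simp
  qed
  then show ?thesis using s(1) unfolding covered_by_def by blast
qed

text \<open>
  The join of two distinct lower covers of \<open>t\<close> is below \<open>t\<close> and strictly above both of them.
\<close>

lemma two_lower_covers:
  assumes xt: "x \<lhd> t" and yt: "y \<lhd> t" and "x \<noteq> y"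
  shows "({x, y}, t) \<in> proper_joins"
proof -
  have le: "x \<sqsubseteq> t" "y \<sqsubseteq> t" and ne: "x \<noteq> t" "y \<noteq> t"
    and x: "\<And>z. x \<sqsubseteq> z \<Longrightarrow> z \<sqsubseteq> t \<Longrightarrow> z = x \<or> z = t" and y: "\<And>z. y \<sqsubseteq> z \<Longrightarrow> z \<sqsubseteq> t \<Longrightarrow> z = y \<or> z = t"
    using xt yt unfolding covered_by_def by blast+
  have inc: "\<not> x \<sqsubseteq> y" "\<not> y \<sqsubseteq> x" using x[of y] y[of x] le ne \<open>x \<noteq> y\<close> by auto
  obtain c where c: "({x, y}, c) \<in> proper_joins" "c \<sqsubseteq> t"
    using incomparable_bounded[OF le inc] by blast
  then have "x \<sqsubseteq> c" "y \<sqsubseteq> c" unfolding proper_joins_iff is_join_def by blast+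
  then have "c = t" using x[of c] c(2) inc by blast
  then show ?thesis using c by simp
qed

text \<open>
  A lowest element \<open>t\<close> among those not drawn yet has all its lower covers in the drawing. As \<open>t\<close> is not
  a proper join, there is only one of them, and \<open>t\<close> is a pendant vertex.
\<close>

lemma drawing_extends:
  assumes "drawing V (covers_in V) p" and "V \<noteq> {}" and "\<And>x y. y \<in> V \<Longrightarrow> x \<sqsubseteq> y \<Longrightarrow> x \<in> V"
    and "\<And>e t. (e, t) \<in> proper_joins \<Longrightarrow> t \<in> V"
  shows "\<exists>q. drawing UNIV (covers_in UNIV) q"
  using assms
proof (induction "card (- V)" arbitrary: V p rule: less_induct)
  case less
  show ?case
  proof (cases "V = UNIV")
    case True
    then show ?thesis using less.prems(1) by blast
  next
    case False
    then have "Min (height ` (- V)) \<in> height ` (- V)" by (intro Min_in) auto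
    then obtain t where t: "t \<notin> V" "height t = Min (height ` (- V))" by auto
    have below: "x \<in> V" if "x \<sqsubseteq> t" "x \<noteq> t" for x
    proof (rule ccontr)
      assume "x \<notin> V"
      then have "height t \<le> height x" using t(2) by simp
      then show False using height_less[OF that] by simp
    qed
    have "bottom \<in> V" using less.prems(2,3) bottom_le by blast
    then have "t \<noteq> bottom" using t(1) by blast
    then obtain s where s: "s \<lhd> t" using lower_cover_exists by blast
    have sV: "s \<in> V" using s below unfolding covered_by_def by blast
    have "x = s" if "x \<lhd> t" for x
    proof (rule ccontr)
      assume "x \<noteq> s"
      then show False using less.prems(4)[OF two_lower_covers[OF that s]] t(1) by simp
    qed
    then have "x \<lhd> t \<longleftrightarrow> x = s" for x using s by blast
    then have "covers_in (insert t V) = insert (s, t) (covers_in V)"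
      by (auto simp: covers_in_def)
    moreover have "covers_in V \<subseteq> V \<times> V"
      by (auto simp: covers_in_def covered_by_def intro: less.prems(3))
    ultimately obtain q where q: "drawing (insert t V) (covers_in (insert t V)) q"
      using drawing_add_pendant[OF less.prems(1) _ _ sV t(1)] by auto
    have "- insert t V \<subset> - V" using t(1) by blast
    then have "card (- insert t V) < card (- V)" by (intro psubset_card_mono) auto
    then show ?thesis
    proof (rule less.hyps[OF _ q])
      show "x \<in> insert t V" if "y \<in> insert t V" "x \<sqsubseteq> y" for x y
        using that below less.prems(3)[of y x] by (cases "y = t") auto
    qed (use less.prems(4) in auto)
  qed
qed

lemma planar_of_drawing:
  assumes "drawing UNIV (covers_in UNIV) p"
  shows "planar_semilattice m"
  using assms
  unfolding planar_semilattice_def planar_hasse_diagram_def hasse_diagram_def drawing_def covers_in_def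
  by (intro exI[of _ p]) simp

text \<open>
  Two elements below \<open>c\<close> that are both different from \<open>a\<close> are comparable, for otherwise they would
  form a pair without \<open>a\<close>. All edges between the two columns end in \<open>a\<close>, and hence they do not cross.
\<close>

lemma drawing_below_single_join:
  assumes joins: "\<forall>e d. (e, d) \<in> proper_joins \<longrightarrow> a \<in> e \<and> d = c"
  shows "\<exists>p. drawing {x. x \<sqsubseteq> c} (covers_in {x. x \<sqsubseteq> c}) p"
proof -
  let ?V = "{x. x \<sqsubseteq> c}"
  let ?col = "\<lambda>x. if x = a then 1 else 0 :: int"
  have cmp: "x \<sqsubseteq> y \<or> y \<sqsubseteq> x" if "x \<in> ?V" "y \<in> ?V" "?col x = ?col y" for x y
  proof (cases "x = a")
    case True
    then show ?thesis using that(3) refl by (auto split: if_splits)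
  next
    case False
    then have "a \<notin> {x, y}" using that(3) by (auto split: if_splits)
    moreover have "a \<in> {x, y}" if "({x, y}, d) \<in> proper_joins" for d
      using joins that by blast
    ultimately show ?thesis using incomparable_bounded[of x c y] that(1,2) by blast
  qed
  have E: "x \<lhd> y" "x \<sqsubseteq> y" "x \<noteq> y" "x \<in> ?V" "y \<in> ?V" if "(x, y) \<in> covers_in ?V" for x y
  proof -
    have xy: "x \<lhd> y" "y \<sqsubseteq> c" using that by (auto simp: covers_in_def)
    then have "x \<sqsubseteq> y" "x \<noteq> y" by (auto simp: covered_by_def)
    then show "x \<lhd> y" "x \<sqsubseteq> y" "x \<noteq> y" "x \<in> ?V" "y \<in> ?V" using xy trans[of x y c] by simp_all
  qed
  have "drawing ?V (covers_in ?V) (\<lambda>x. (real_of_int (?col x), real (height x)))"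
  proof (rule drawing_in_columns)
    show "x = y" if "x \<in> ?V" "y \<in> ?V" "?col x = ?col y" "height x = height y" for x y
      using eq_of_height_eq[OF cmp[OF that(1-3)] that(4)] .
    show "covers_in ?V \<subseteq> ?V \<times> ?V"
    proof (rule subrelI)
      show "(x, y) \<in> ?V \<times> ?V" if "(x, y) \<in> covers_in ?V" for x y
        using E(4,5)[OF that] by (rule SigmaI)
    qed
    show "height x < height y" if "(x, y) \<in> covers_in ?V" for x y
      using height_less[OF E(2,3)[OF that]] .
    show "\<bar>?col x - ?col y\<bar> \<le> 1" for x y by simp
    show "z = x \<or> z = y"
      if "(x, y) \<in> covers_in ?V" "z \<in> ?V" "?col x = ?col z" "?col y = ?col z"
        "height x \<le> height z" "height z \<le> height y" for x y z
      using covers_gap[OF E(1)[OF that(1)] cmp[OF E(4)[OF that(1)] that(2,3)]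
          cmp[OF E(5)[OF that(1)] that(2,4)] that(5,6)] .
    show "height s \<le> height s' \<and> height t \<le> height t' \<or> height s' \<le> height s \<and> height t' \<le> height t"
      if "?col t' = ?col t" "?col t = ?col s + 1" for s t s' t'
    proof -
      have "t = a" using that(2) by (cases "t = a"; cases "s = a") simp_all
      moreover from this have "t' = a" using that(1) by (cases "t' = a") simp_all
      ultimately show ?thesis by auto
    qed
  qed
  then show ?thesis by blast
qed

text \<open>
  If \<open>c\<close> were below \<open>c'\<close>, then \<open>c\<close> and \<open>b'\<close> would be two elements below \<open>c'\<close>. They are incomparable,
  since \<open>c\<close> below \<open>b'\<close> would put \<open>a\<close> below \<open>b'\<close>, and \<open>b'\<close> below \<open>c\<close> would put \<open>c'\<close> below \<open>c\<close>. This
  gives a third pair.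
\<close>

lemma two_joins_not_le:
  assumes D: "proper_joins = {({a, b}, c), ({a, b'}, c')}" and ne: "c \<noteq> c'"
  shows "\<not> c \<sqsubseteq> c'"
proof
  assume cc: "c \<sqsubseteq> c'"
  have "({a, b}, c) \<in> proper_joins" "({a, b'}, c') \<in> proper_joins" by (simp_all add: D)
  then have 1: "\<not> a \<sqsubseteq> b" "\<not> b \<sqsubseteq> a" "is_join a b c" and 2: "\<not> a \<sqsubseteq> b'" "\<not> b' \<sqsubseteq> a" "is_join a b' c'"
    unfolding proper_joins_iff by blast+
  have "b' \<sqsubseteq> c'" "a \<sqsubseteq> c" "b \<sqsubseteq> c" using 1 2 unfolding is_join_def by blast+
  have n1: "\<not> c \<sqsubseteq> b'" using \<open>a \<sqsubseteq> c\<close> 2(1) trans by blast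
  have n2: "\<not> b' \<sqsubseteq> c" using \<open>a \<sqsubseteq> c\<close> 2(3) cc ne antisym unfolding is_join_def by blast
  obtain d where "({c, b'}, d) \<in> proper_joins"
    using incomparable_bounded[OF cc \<open>b' \<sqsubseteq> c'\<close> n1 n2] by blast
  then have "a \<in> {c, b'}" by (auto simp: D)
  then show False using 1(2) 2(2) \<open>b \<sqsubseteq> c\<close> refl by blast
qed

text \<open>
  For the last part, an element \<open>x\<close> strictly below \<open>c\<close>, other than \<open>b\<close> and not below \<open>a\<close>, would be
  above \<open>a\<close>, since otherwise \<open>x\<close> and \<open>a\<close> would form a further pair, or \<open>x\<close> would be \<open>b'\<close>, which is not
  below \<open>c\<close>. Then \<open>x\<close> cannot be comparable to \<open>b\<close>: being below \<open>b\<close> would put \<open>a\<close> below \<open>b\<close>, and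
  being above \<open>b\<close> would put \<open>x\<close> above \<open>c\<close>. So \<open>x\<close> and \<open>b\<close> form a further pair.
\<close>

lemma below_first_of_two_joins:
  assumes D: "proper_joins = {({a, b}, c), ({a, b'}, c')}" and ne: "c \<noteq> c'"
  shows "\<not> b \<sqsubseteq> c'" "\<not> b \<sqsubseteq> a" "\<not> c \<sqsubseteq> a" "b \<sqsubseteq> c" "a \<sqsubseteq> c" "a \<noteq> c"
    "x \<sqsubseteq> c \<Longrightarrow> x = b \<or> x = c \<or> x \<sqsubseteq> a"
proof -
  have D': "proper_joins = {({a, b'}, c'), ({a, b}, c)}" by (simp add: D insert_commute)
  note cc = two_joins_not_le[OF D ne] two_joins_not_le[OF D' ne[symmetric]]
  have "({a, b}, c) \<in> proper_joins" "({a, b'}, c') \<in> proper_joins" by (simp_all add: D)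
  then have 1: "\<not> a \<sqsubseteq> b" "\<not> b \<sqsubseteq> a" "is_join a b c" and 2: "\<not> a \<sqsubseteq> b'" "\<not> b' \<sqsubseteq> a" "is_join a b' c'"
    unfolding proper_joins_iff by blast+
  show "b \<sqsubseteq> c" "a \<sqsubseteq> c" "\<not> b \<sqsubseteq> a" using 1 unfolding is_join_def by blast+
  then show "\<not> c \<sqsubseteq> a" "a \<noteq> c" using trans by blast+
  show "\<not> b \<sqsubseteq> c'" using cc(1) 1(3) 2(3) unfolding is_join_def by blast
  show "x = b \<or> x = c \<or> x \<sqsubseteq> a" if x: "x \<sqsubseteq> c"
  proof (rule ccontr)
    assume no: "\<not> ?thesis"
    have in_D: "u = a \<or> v = a" "u = b \<or> u = b' \<or> v = b \<or> v = b'" if "({u, v}, d) \<in> proper_joins" for u v d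
      using that by (auto simp: D doubleton_eq_iff)
    have "a \<sqsubseteq> x"
    proof (rule ccontr)
      assume "\<not> a \<sqsubseteq> x"
      then obtain d where "({x, a}, d) \<in> proper_joins"
        using incomparable_bounded[OF x \<open>a \<sqsubseteq> c\<close>] no by blast
      then have "x = b \<or> x = b'" using in_D(2) 1(1) 2(1) refl by blast
      then have "b' \<sqsubseteq> c" using no x by blast
      then show False using cc(2) \<open>a \<sqsubseteq> c\<close> 2(3) unfolding is_join_def by blast
    qed
    have "\<not> x \<sqsubseteq> b" using \<open>a \<sqsubseteq> x\<close> 1(1) trans by blast
    moreover have "\<not> b \<sqsubseteq> x" using \<open>a \<sqsubseteq> x\<close> 1(3) x no antisym unfolding is_join_def by blast
    ultimately obtain d where "({x, b}, d) \<in> proper_joins"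
      using incomparable_bounded[OF x \<open>b \<sqsubseteq> c\<close>] by blast
    then show False using in_D(1) no 1(1) refl by blast
  qed
qed

text \<open>
  No edge leads from the left column \<open>b < c\<close> to the right column \<open>b' < c'\<close> or back. In the left
  strip, all edges go up from the middle to the left column, and \<open>a\<close> is the only lower cover of \<open>c\<close>
  in the middle column. As \<open>a\<close> is the top of that column and \<open>c\<close> the top of the left one, this edge
  does not cross any edge that ends in \<open>b\<close>. The right strip is symmetric.
\<close>

lemma drawing_below_two_joins:
  assumes D: "proper_joins = {({a, b}, c), ({a, b'}, c')}" and ne: "c \<noteq> c'"
  shows "\<exists>p. drawing {x. x \<sqsubseteq> c \<or> x \<sqsubseteq> c'} (covers_in {x. x \<sqsubseteq> c \<or> x \<sqsubseteq> c'}) p"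
proof -
  let ?V = "{x. x \<sqsubseteq> c \<or> x \<sqsubseteq> c'}"
  have D': "proper_joins = {({a, b'}, c'), ({a, b}, c)}" by (simp add: D insert_commute)
  note P = below_first_of_two_joins[OF D ne]
  note P' = below_first_of_two_joins[OF D' ne[symmetric]]
  define col where "col x = (if x \<in> {b, c} then - 1 else if x \<in> {b', c'} then 1 else 0 :: int)" for x
  have dis: "x \<notin> {b', c'}" if "x \<in> {b, c}" for x
    using that P P' two_joins_not_le[OF D ne] refl by blast
  have col_left: "col x = - 1 \<longleftrightarrow> x \<in> {b, c}" and col_right: "col x = 1 \<longleftrightarrow> x \<in> {b', c'}" for x
    using dis[of x] by (auto simp: col_def)
  have col_mid: "col x = 0 \<longleftrightarrow> x \<sqsubseteq> a" if "x \<in> ?V" for x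
    using that P(2,3,7) P'(2,3,7) by (auto simp: col_def)
  have col3: "col x = - 1 \<or> col x = 0 \<or> col x = 1" for x by (simp add: col_def)
  have below_a: "x \<sqsubseteq> y \<or> y \<sqsubseteq> x" if x: "x \<sqsubseteq> a" and y: "y \<sqsubseteq> a" for x y
  proof (rule ccontr)
    assume no: "\<not> ?thesis"
    then obtain d where "({x, y}, d) \<in> proper_joins" using incomparable_bounded[OF x y] by blast
    then have "x = a \<or> y = a" by (auto simp: D doubleton_eq_iff)
    then show False using no x y by blast
  qed
  have cmp: "x \<sqsubseteq> y \<or> y \<sqsubseteq> x" if V: "x \<in> ?V" "y \<in> ?V" and same: "col x = col y" for x y
  proof -
    consider "col x = - 1" "col y = - 1" | "col x = 0" "col y = 0" | "col x = 1" "col y = 1"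
      using col3[of x] same by auto
    then show ?thesis
    proof cases
      case 1
      then show ?thesis unfolding col_left using P(4) refl by blast
    next
      case 2
      then show ?thesis unfolding col_mid[OF V(1)] col_mid[OF V(2)] using below_a by blast
    next
      case 3
      then show ?thesis unfolding col_right using P'(4) refl by blast
    qed
  qed
  have E: "x \<lhd> y" "x \<sqsubseteq> y" "x \<noteq> y" "x \<in> ?V" "y \<in> ?V" if "(x, y) \<in> covers_in ?V" for x y
  proof -
    have xy: "x \<lhd> y" "y \<in> ?V" using that by (auto simp: covers_in_def)
    then have "x \<sqsubseteq> y" "x \<noteq> y" by (auto simp: covered_by_def)
    then show "x \<lhd> y" "x \<sqsubseteq> y" "x \<noteq> y" "x \<in> ?V" "y \<in> ?V"
      using xy trans[of x y c] trans[of x y c'] by auto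
  qed
  \<comment> \<open>Here \<open>\<beta>\<close> and \<open>\<gamma>\<close> are either \<open>b\<close> and \<open>c\<close> or \<open>b'\<close> and \<open>c'\<close>.\<close>
  have strip: "height s \<le> height s' \<and> height t \<le> height t' \<or> height s' \<le> height s \<and> height t' \<le> height t"
    if st: "t \<lhd> s" "t' \<lhd> s'" "t \<sqsubseteq> a" "t' \<sqsubseteq> a" "s \<in> {\<beta>, \<gamma>}" "s' \<in> {\<beta>, \<gamma>}"
      and g: "\<beta> \<sqsubseteq> \<gamma>" "a \<sqsubseteq> \<gamma>" "a \<noteq> \<gamma>" for s t s' t' \<beta> \<gamma>
  proof -
    have top: "t = a" if "t \<lhd> \<gamma>" "t \<sqsubseteq> a" for t
      using that g unfolding covered_by_def by blast
    have "s \<sqsubseteq> s' \<and> t \<sqsubseteq> t' \<or> s' \<sqsubseteq> s \<and> t' \<sqsubseteq> t"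
    proof (cases "s = s'")
      case True
      then show ?thesis using below_a st refl by blast
    next
      case False
      then consider "s = \<beta>" "s' = \<gamma>" | "s = \<gamma>" "s' = \<beta>" using st by blast
      then show ?thesis using top st g(1) by cases blast+
    qed
    then show ?thesis using height_le by blast
  qed
  \<comment> \<open>Between the middle and an outer column, all edges go upwards from the middle one.\<close>
  have edge: "t \<lhd> s" if st: "(s, t) \<in> covers_in ?V \<union> (covers_in ?V)\<inverse>" and "t \<sqsubseteq> a" "\<not> s \<sqsubseteq> a" for s t
  proof -
    have "\<not> s \<sqsubseteq> t" using that(2,3) trans by blast
    then show ?thesis using st E(1)[of t s] E(2)[of s t] by blast
  qed
  have "drawing ?V (covers_in ?V) (\<lambda>x. (real_of_int (col x), real (height x)))"
  proof (rule drawing_in_columns)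
    show "x = y" if "x \<in> ?V" "y \<in> ?V" "col x = col y" "height x = height y" for x y
      using eq_of_height_eq[OF cmp[OF that(1-3)] that(4)] .
    show "covers_in ?V \<subseteq> ?V \<times> ?V"
    proof (rule subrelI)
      show "(x, y) \<in> ?V \<times> ?V" if "(x, y) \<in> covers_in ?V" for x y
        using E(4,5)[OF that] by (rule SigmaI)
    qed
    show "height x < height y" if "(x, y) \<in> covers_in ?V" for x y
      using height_less[OF E(2,3)[OF that]] .
    show "\<bar>col x - col y\<bar> \<le> 1" if xy: "(x, y) \<in> covers_in ?V" for x y
    proof -
      have "\<not> (col x = - 1 \<and> col y = 1)"
      proof
        assume "col x = - 1 \<and> col y = 1"
        then have "b \<sqsubseteq> x" "y \<sqsubseteq> c'" unfolding col_left col_right using P(4) P'(4) refl by blast+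
        then show False using E(2)[OF xy] P(1) trans by blast
      qed
      moreover have "\<not> (col x = 1 \<and> col y = - 1)"
      proof
        assume "col x = 1 \<and> col y = - 1"
        then have "b' \<sqsubseteq> x" "y \<sqsubseteq> c" unfolding col_left col_right using P(4) P'(4) refl by blast+
        then show False using E(2)[OF xy] P'(1) trans by blast
      qed
      ultimately show ?thesis using col3[of x] col3[of y] by auto
    qed
    show "z = x \<or> z = y"
      if "(x, y) \<in> covers_in ?V" "z \<in> ?V" "col x = col z" "col y = col z"
        "height x \<le> height z" "height z \<le> height y" for x y z
      using covers_gap[OF E(1)[OF that(1)] cmp[OF E(4)[OF that(1)] that(2,3)]
          cmp[OF E(5)[OF that(1)] that(2,4)] that(5,6)] .
    show "height s \<le> height s' \<and> height t \<le> height t' \<or> height s' \<le> height s \<and> height t' \<le> height t"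
      if st: "(s, t) \<in> covers_in ?V \<union> (covers_in ?V)\<inverse>" "(s', t') \<in> covers_in ?V \<union> (covers_in ?V)\<inverse>"
        and cols: "col s' = col s" "col t' = col t" "col t = col s + 1" for s t s' t'
    proof -
      have V: "s \<in> ?V" "t \<in> ?V" "s' \<in> ?V" "t' \<in> ?V"
        using st E(4,5)[of s t] E(4,5)[of t s] E(4,5)[of s' t'] E(4,5)[of t' s'] by blast+
      note left = col_left[THEN iffD1] and right = col_right[THEN iffD1]
      consider "col s = - 1" "col t = 0" | "col s = 0" "col t = 1"
        using col3[of s] col3[of t] cols(3) by auto
      then show ?thesis
      proof cases
        case 1
        then have *: "s \<in> {b, c}" "s' \<in> {b, c}" "t \<sqsubseteq> a" "t' \<sqsubseteq> a"
          using left[of s] left[of s'] col_mid[OF V(2)] col_mid[OF V(4)] cols by simp_all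
        then have "t \<lhd> s" "t' \<lhd> s'" using edge[OF st(1)] edge[OF st(2)] P(2,3) by blast+
        then show ?thesis using strip[OF _ _ *(3,4,1,2) P(4,5,6)] by blast
      next
        case 2
        then have *: "t \<in> {b', c'}" "t' \<in> {b', c'}" "s \<sqsubseteq> a" "s' \<sqsubseteq> a"
          using right[of t] right[of t'] col_mid[OF V(1)] col_mid[OF V(3)] cols by simp_all
        have "s \<lhd> t" "s' \<lhd> t'" using edge[of t s] edge[of t' s'] st * P'(2,3) by blast+
        then show ?thesis using strip[OF _ _ *(3,4,1,2) P'(4,5,6)] by blast
      qed
    qed
  qed
  then show ?thesis by blast
qed

lemma many_congruences_imp_planar:
  assumes "64 * real (card (congruences m)) \<ge> 25 * 2 ^ CARD('a)"
  shows "planar_semilattice m"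
  using few_proper_joins[OF assms]
proof (elim disjE exE conjE)
  fix a c assume joins: "\<forall>e d. (e, d) \<in> proper_joins \<longrightarrow> a \<in> e \<and> d = c"
  obtain p where "drawing {x. x \<sqsubseteq> c} (covers_in {x. x \<sqsubseteq> c}) p"
    using drawing_below_single_join[OF joins] by blast
  then have "\<exists>q. drawing UNIV (covers_in UNIV) q"
  proof (rule drawing_extends)
    show "{x. x \<sqsubseteq> c} \<noteq> {}" using refl by blast
    show "t \<in> {x. x \<sqsubseteq> c}" if "(e, t) \<in> proper_joins" for e t
      using that joins refl by blast
  qed (use trans in blast)
  then show ?thesis using planar_of_drawing by blast
next
  fix a b b' c c' assume D: "proper_joins = {({a, b}, c), ({a, b'}, c')}" "c \<noteq> c'"
  obtain p where "drawing {x. x \<sqsubseteq> c \<or> x \<sqsubseteq> c'} (covers_in {x. x \<sqsubseteq> c \<or> x \<sqsubseteq> c'}) p"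
    using drawing_below_two_joins[OF D] by blast
  then have "\<exists>q. drawing UNIV (covers_in UNIV) q"
  proof (rule drawing_extends)
    show "{x. x \<sqsubseteq> c \<or> x \<sqsubseteq> c'} \<noteq> {}" using refl by blast
    show "t \<in> {x. x \<sqsubseteq> c \<or> x \<sqsubseteq> c'}" if "(e, t) \<in> proper_joins" for e t
      using that refl by (auto simp: D)
  qed (use trans in blast)
  then show ?thesis using planar_of_drawing by blast
qed

end

theorem corollary2p5:
  fixes m :: "'a::finite \<Rightarrow> 'a \<Rightarrow> 'a" and n :: nat
  assumes "semilattice m"
    and "CARD('a) = n"
    and "real (card (congruences m)) \<ge> 25 * 2 powi (int n - 6)"
  shows "planar_semilattice m"
proof -
  interpret finite_meet_semilattice m
    using assms(1) by (simp add: finite_meet_semilattice_def)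
  have "(2::real) powi (int n - 6) = 2 ^ n / 64"
    by (simp add: power_int_diff)
  then show ?thesis
    using many_congruences_imp_planar assms(2,3) by simp
qed

end
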